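(* Let $(Z_i)_{i\in\mathbb{N}}$ be i.i.d. random variables with $\mathbb{P}(Z_1=1)=\mathbb{P}(Z_1=-1)=\frac12$. For each $n\in\mathbb{N}$, $n\ge 1$, let $\mu_n$ be the distribution of $\sum_{i=1}^{2n-1}Z_i$ and let $\nu_n$ be the distribution of $\sum_{i=1}^{2n}Z_i$. Then $$\lim_{n\to\infty}\sqrt{n}\,\mathcal{T}(\mu_n*\mu_n,\nu_n*\nu_n)=\frac{2}{\sqrt{2\pi}},$$ while $\mathcal{T}(\mu_n*\mu_n*\mu_n,\nu_n*\nu_n*\nu_n)\ge 1$ for all $n\in\mathbb{N}$.
   Context: For Borel probability measures $\mu,\nu$ on $\mathbb{R}^d$ (here $d=1$), the quadratic Wasserstein distance is defined (without taking a square root) by $$\mathcal{T}(\mu,\nu):=\inf_{(X,Y)}\mathbb{E}\bigl[\|X-Y\|^2\bigr],$$ where $\|\cdot\|$ is the Euclidean norm and the infimum runs over all pairs of random vectors $(X,Y)$ defined on some common probability space such that $X$ has distribution $\mu$ and $Y$ has distribution $\nu$. The symbol $*$ denotes convolution of measures. *)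

theory Defs
  imports "HOL-Probability.Probability"
begin

text \<open>
  The infimum should range over pairs of random vectors on arbitrary probability spaces, which
  cannot be quantified over inside a definition. Only the joint law of the pair matters, so it is
  enough to let the sample spaces be subsets of \<^typ>\<open>'a \<times> 'a\<close>; lemma \<open>wasserstein2_le\<close> below shows
  that sample spaces of any other type do not give smaller values. The cost is an
  extended nonnegative real, since second moments may be infinite.
\<close>

definition wasserstein2 ::
    "'a::euclidean_space measure \<Rightarrow> 'a measure \<Rightarrow> ennreal" where
  "wasserstein2 \<mu> \<nu> =
     Inf {\<integral>\<^sup>+\<omega>. ennreal ((norm (X \<omega> - Y \<omega>))\<^sup>2) \<partial>M | (M :: ('a \<times> 'a) measure) X Y.
            prob_space M \<and> X \<in> borel_measurable M \<and> Y \<in> borel_measurable M \<and>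
            distr M borel X = \<mu> \<and> distr M borel Y = \<nu>}"

lemma wasserstein2_le:
  fixes M :: "'b measure" and X Y :: "'b \<Rightarrow> 'a::euclidean_space"
  assumes "prob_space M"
    and [measurable]: "X \<in> borel_measurable M" "Y \<in> borel_measurable M"
    and "distr M borel X = \<mu>" "distr M borel Y = \<nu>"
  shows "wasserstein2 \<mu> \<nu> \<le> (\<integral>\<^sup>+\<omega>. ennreal ((norm (X \<omega> - Y \<omega>))\<^sup>2) \<partial>M)"
proof -
  let ?N = "distr M borel (\<lambda>\<omega>. (X \<omega>, Y \<omega>)) :: ('a \<times> 'a) measure"
  have [measurable]: "(\<lambda>\<omega>. (X \<omega>, Y \<omega>)) \<in> borel_measurable M"
    by (intro borel_measurable_Pair) measurable
  have [measurable]: "(fst :: 'a \<times> 'a \<Rightarrow> 'a) \<in> borel_measurable borel"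
       "(snd :: 'a \<times> 'a \<Rightarrow> 'a) \<in> borel_measurable borel"
    by (auto intro!: borel_measurable_continuous_onI continuous_intros)
  have N: "prob_space ?N"
    by (rule prob_space.prob_space_distr[OF assms(1)]) measurable
  have f: "distr ?N borel fst = \<mu>"
    by (subst distr_distr) (use assms(4) in \<open>auto simp: comp_def\<close>)
  have s: "distr ?N borel snd = \<nu>"
    by (subst distr_distr) (use assms(5) in \<open>auto simp: comp_def\<close>)
  have "(\<integral>\<^sup>+\<omega>. ennreal ((norm (X \<omega> - Y \<omega>))\<^sup>2) \<partial>M) =
        (\<integral>\<^sup>+z. ennreal ((norm (fst z - snd z))\<^sup>2) \<partial>?N)"
    by (subst nn_integral_distr) auto
  then show ?thesis
    unfolding wasserstein2_def
    by (intro Inf_lower CollectI exI[of _ ?N] exI[of _ fst] exI[of _ snd]) (use N f s in simp)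
qed

end

theory Submission
  imports Defs
begin

text \<open>
  Write \<open>p\<^sub>m\<close> for the law of the simple symmetric random walk on the integers after \<open>m\<close> steps. The
  convolutions in the claim are again laws of the walk: after \<open>4n - 2\<close> and \<open>4n\<close> steps for two
  factors, after \<open>6n - 3\<close> and \<open>6n\<close> steps for three. With three factors the parities differ, so
  the two random variables are never closer than distance one.

  With two factors both numbers of steps are even, and the transport cost is exactly
  \<open>2 p\<^sub>m(0)\<close> for \<open>m = 4n - 2\<close> (lemma \<open>wasserstein2_walk\<close>). The reason is that both sides of the
  estimate measure how much the mean absolute value grows, and it grows only at the origin:
  a step changes \<open>\<bar>x\<bar>\<close> by zero on average unless \<open>x = 0\<close>, where it adds one. Hence
  \<open>E \<bar>S\<^sub>m\<^sub>+\<^sub>2\<bar> - E \<bar>S\<^sub>m\<bar> = p\<^sub>m(0)\<close> for even \<open>m\<close>.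

  For the lower bound, even integers satisfy \<open>(x - y)\<^sup>2 \<ge> 2 \<bar>x - y\<bar> \<ge> 2 (\<bar>y\<bar> - \<bar>x\<bar>)\<close>; take expectations.
  For the upper bound one needs a coupling under which both inequalities are equalities, that is,
  one that only moves mass outwards, and by exactly two. Two steps of the walk send mass \<open>p\<^sub>m(x)/4\<close> from
  \<open>x\<close> to \<open>x + 2\<close> and mass \<open>p\<^sub>m(x + 2)/4\<close> back. Cancelling these opposite flows leaves the
  marginals unchanged and keeps only the excess, which runs from the larger to the smaller of
  the two values; since \<open>p\<^sub>m\<close> is symmetric and unimodal on its lattice, that is outwards.

  Finally \<open>p\<^sub>2\<^sub>k(0)\<close> is the central binomial probability, whose asymptotics \<open>1 / sqrt (\<pi> k)\<close> are
  Wallis' product; here \<open>k = 2n - 1\<close>.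
\<close>

section \<open>The simple symmetric random walk on the integers\<close>

primrec walk :: "nat \<Rightarrow> int pmf" where
  "walk 0 = return_pmf 0"
| "walk (Suc m) = bind_pmf (walk m) (\<lambda>x. map_pmf (\<lambda>s. x + s) (pmf_of_set {- 1, 1}))"

lemma pmf_walk_Suc: "pmf (walk (Suc m)) x = (pmf (walk m) (x - 1) + pmf (walk m) (x + 1)) / 2"
proof -
  have "walk (Suc m) = bind_pmf (pmf_of_set {- 1, 1}) (\<lambda>s. map_pmf (\<lambda>y. y + s) (walk m))"
    by (simp add: map_pmf_def bind_commute_pmf[of "walk m"])
  moreover have "pmf (map_pmf (\<lambda>y. y + s) (walk m)) x = pmf (walk m) (x - s)" for s
    using pmf_map_inj'[of "\<lambda>y. y + s" "walk m" "x - s"] by (simp add: inj_def)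
  ultimately show ?thesis
    by (simp add: pmf_bind_pmf_of_set)
qed

lemma walk_add: "walk (m + n) = bind_pmf (walk m) (\<lambda>x. map_pmf (\<lambda>y. x + y) (walk n))"
  by (induction n) (simp_all add: map_pmf_def bind_assoc_pmf bind_return_pmf bind_return_pmf' add.assoc)

lemma walk_parity: "x \<in> set_pmf (walk m) \<Longrightarrow> even x = even m"
  by (induction m arbitrary: x) auto

lemma pmf_walk_wrong_parity: "even x \<noteq> even m \<Longrightarrow> pmf (walk m) x = 0"
  using walk_parity[of x m] by (auto simp: set_pmf_iff)

lemma pmf_walk_uminus: "pmf (walk m) (- x) = pmf (walk m) x"
proof (induction m arbitrary: x)
  case (Suc m)
  show ?case
  proof -
    have "- x - 1 = - (x + 1)" "- x + 1 = - (x - 1)" by simp_all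
    then show ?thesis
      unfolding pmf_walk_Suc by (simp only: Suc add.commute)
  qed
qed (simp add: indicator_def)

text \<open>
  Points of the wrong parity have mass zero, so unimodality can only be asked for along steps of
  length two. The range starts at \<open>- 1\<close> rather than \<open>0\<close> to make the induction close: a step to the
  left of \<open>x = 0\<close> leads to \<open>- 1\<close>, and there the claim is an equality by symmetry.
\<close>

lemma walk_unimodal: "x \<ge> - 1 \<Longrightarrow> pmf (walk m) (x + 2) \<le> pmf (walk m) x"
proof (induction m arbitrary: x)
  case (Suc m)
  show ?case
  proof (cases "x = - 1")
    case True
    then show ?thesis
      unfolding pmf_walk_Suc using pmf_walk_uminus[of m 2] by simp
  next
    case False
    then show ?thesis
      unfolding pmf_walk_Suc using Suc.IH[of "x - 1"] Suc.IH[of "x + 1"] Suc.prems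
      by (simp add: algebra_simps)
  qed
qed simp

text \<open>
  This is the form in which unimodality enters: a mass that flows down the gradient of the
  density moves away from the origin.
\<close>

lemma walk_drop_outward:
  assumes "pmf (walk m) (x + s) < pmf (walk m) x" "s \<in> {- 2, 2}"
  shows "\<bar>x + s\<bar> = \<bar>x\<bar> + 2"
proof (cases "s = 2")
  case True
  have "x \<ge> 0"
  proof (rule ccontr)
    assume "\<not> x \<ge> 0"
    with walk_unimodal[of "- (x + 2)" m] pmf_walk_uminus[of m "x + 2"] pmf_walk_uminus[of m x]
    show False using assms True by (simp add: algebra_simps)
  qed
  with True show ?thesis by simp
next
  case False
  then have "s = - 2" using assms by simp
  have "x \<le> 0"
  proof (rule ccontr)
    assume "\<not> x \<le> 0"
    with walk_unimodal[of "x - 2" m] show False using assms \<open>s = - 2\<close> by simp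
  qed
  with \<open>s = - 2\<close> show ?thesis by simp
qed

lemma pmf_walk_binomial: "k \<le> m \<Longrightarrow> pmf (walk m) (2 * int k - int m) = real (m choose k) / 2 ^ m"
proof (induction m arbitrary: k)
  case (Suc m)
  \<comment> \<open>The boundary terms of Pascal's rule: the walk cannot leave the interval from \<open>- m\<close> to \<open>m\<close>.\<close>
  have out: "pmf (walk m) x = 0" if "\<bar>x\<bar> > int m" for x
    using that
  proof (induction m arbitrary: x)
    case (Suc m)
    then show ?case by (simp add: pmf_walk_Suc del: walk.simps)
  qed simp
  show ?case
  proof (cases k)
    case 0
    then show ?thesis
      unfolding pmf_walk_Suc using Suc.IH[of 0] out[of "- int m - 2"] by (simp add: algebra_simps)
  next
    case (Suc l)
    note k = this
    show ?thesis
    proof (cases "k = Suc m")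
      case True
      then show ?thesis
        unfolding pmf_walk_Suc using k Suc.IH[of m] out[of "int m + 2"] by (simp add: algebra_simps)
    next
      case False
      with Suc.prems k have "k \<le> m" "l \<le> m" by simp_all
      then show ?thesis
        unfolding pmf_walk_Suc using k Suc.IH[of k] Suc.IH[of l]
        by (simp add: algebra_simps add_divide_distrib)
    qed
  qed
qed simp

section \<open>Asymptotics of the return probability\<close>

text \<open>
  The inverse square of the \<open>k\<close>-th term is exactly the \<open>k\<close>-th partial product of Wallis' formula.
\<close>

lemma wallis_central_binomial:
  "(\<lambda>k. sqrt (2 * real k + 1) * (real (2 * k choose k) / 4 ^ k)) \<longlonglongrightarrow> sqrt (2 / pi)"
proof -
  have eq: "(\<Prod>j=1..k. (4 * real j ^ 2) / (4 * real j ^ 2 - 1)) =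
      inverse ((sqrt (2 * real k + 1) * (real (2 * k choose k) / 4 ^ k))\<^sup>2)" for k
  proof (induction k)
    case (Suc k)
    define c where "c = real (2 * k choose k) / 4 ^ k"
    have "(k + 1) * (2 * (k + 1) choose (k + 1)) = 2 * (2 * k + 1) * (2 * k choose k)"
    proof -
      have "(2 * k + 1 choose k) = (2 * k + 1 choose (k + 1))"
        by (subst binomial_symmetric) simp_all
      with Suc_times_binomial[of k "2 * k"] Suc_times_binomial[of k "2 * k + 1"]
      show ?thesis
        by (simp add: algebra_simps)
    qed
    then have "(real k + 1) * real (2 * (k + 1) choose (k + 1)) = 2 * (2 * real k + 1) * real (2 * k choose k)"
      by (metis (no_types, lifting) of_nat_1 of_nat_add of_nat_mult of_nat_numeral)
    then have "real (2 * Suc k choose Suc k) = 2 * (2 * real k + 1) * real (2 * k choose k) / (real k + 1)"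
      unfolding Suc_eq_plus1 by (simp add: field_simps del: binomial_Suc_Suc)
    moreover have aux: "2 * (2 * t + 1) * b / (t + 1) / (4 * p) = b / p * (2 * t + 1) / (2 * (t + 1))"
      if "t \<ge> 0" "p > 0" for t p b :: real
      using that by (simp add: divide_simps) (simp add: algebra_simps)
    ultimately have c: "real (2 * Suc k choose Suc k) / 4 ^ Suc k = c * (2 * real k + 1) / (2 * (real k + 1))"
      using aux[of "real k" "4 ^ k" "real (2 * k choose k)"]
      by (simp add: c_def del: binomial_Suc_Suc mult_Suc_right)
    have "(\<Prod>j=1..Suc k. (4 * real j ^ 2) / (4 * real j ^ 2 - 1)) =
        inverse ((2 * real k + 1) * c\<^sup>2) * (4 * (real k + 1)\<^sup>2 / (4 * (real k + 1)\<^sup>2 - 1))"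
      using Suc.IH
      by (simp add: c_def power_mult_distrib power_divide add.commute del: binomial_Suc_Suc)
    also have "4 * (real k + 1)\<^sup>2 - 1 = (2 * real k + 1) * (2 * real k + 3)"
      by (simp add: power2_eq_square algebra_simps)
    also have "inverse ((2 * real k + 1) * c\<^sup>2) * (4 * (real k + 1)\<^sup>2 / ((2 * real k + 1) * (2 * real k + 3)))
        = inverse ((2 * real k + 3) * (c * (2 * real k + 1) / (2 * (real k + 1)))\<^sup>2)"
      by (simp add: field_simps power2_eq_square)
    finally show ?case
      unfolding c power_mult_distrib[of "sqrt _"] by (simp add: add.commute)
  qed simp
  have "(\<lambda>k. (sqrt (2 * real k + 1) * (real (2 * k choose k) / 4 ^ k))\<^sup>2) \<longlonglongrightarrow> inverse (pi / 2)"
    using tendsto_inverse[OF wallis] unfolding eq by simp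
  from tendsto_real_sqrt[OF this] show ?thesis by simp
qed

text \<open>
  Here \<open>k = 2n - 1\<close>, so \<open>2k + 1 = 4n - 1\<close>, and \<open>n / (4n - 1)\<close> tends to \<open>1 / 4\<close>.
\<close>

lemma walk_return_asymptotics:
  "(\<lambda>n. sqrt (real n) * (2 * pmf (walk (4 * n - 2)) 0)) \<longlonglongrightarrow> 2 / sqrt (2 * pi)"
proof -
  define r where "r k = real (2 * k choose k) / 4 ^ k" for k
  have ret: "pmf (walk (2 * k)) 0 = r k" for k
    using pmf_walk_binomial[of k "2 * k"] by (simp add: r_def power_mult)
  have "filterlim (\<lambda>n. 2 * n - 1 :: nat) at_top at_top"
    by (rule filterlim_at_top_mono[OF filterlim_ident]) (auto intro: eventually_sequentiallyI[of 1])
  from filterlim_compose[OF wallis_central_binomial this]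
  have lim: "(\<lambda>n. sqrt (2 * real (2 * n - 1) + 1) * r (2 * n - 1)) \<longlonglongrightarrow> sqrt (2 / pi)"
    by (simp add: r_def)
  have factor_lim: "(\<lambda>n. 2 * sqrt (1 / (4 - 1 / real n))) \<longlonglongrightarrow> 2 * sqrt (1 / (4 - 0))"
    by (intro tendsto_intros lim_1_over_n) simp
  have "(\<lambda>n. 2 * sqrt (1 / (4 - 1 / real n)) * (sqrt (2 * real (2 * n - 1) + 1) * r (2 * n - 1)))
      \<longlonglongrightarrow> 2 / sqrt (2 * pi)"
  proof -
    have "sqrt (2 / pi) = sqrt (4 / (2 * pi))" by simp
    also have "\<dots> = 2 / sqrt (2 * pi)"
      by (simp only: real_sqrt_divide real_sqrt_four)
    finally have "2 * sqrt (1 / (4 - 0)) * sqrt (2 / pi) = 2 / sqrt (2 * pi)"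
      by (simp add: real_sqrt_divide[of 1])
    with tendsto_mult[OF factor_lim lim] show ?thesis by (simp only:)
  qed
  moreover have "\<forall>\<^sub>F n in sequentially.
      2 * sqrt (1 / (4 - 1 / real n)) * (sqrt (2 * real (2 * n - 1) + 1) * r (2 * n - 1)) =
      sqrt (real n) * (2 * pmf (walk (4 * n - 2)) 0)"
    using eventually_ge_at_top[of 1]
  proof eventually_elim
    case (elim n)
    then have "4 * n - 2 = 2 * (2 * n - 1)" "2 * real (2 * n - 1) + 1 = 4 * real n - 1" "4 * real n - 1 > 0"
      by (simp_all add: of_nat_diff)
    moreover have "1 / (4 - 1 / real n) = real n / (4 * real n - 1)"
      using elim by (simp add: field_simps)
    ultimately show ?case
      by (simp only: ret) (simp add: real_sqrt_divide)
  qed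
  ultimately show ?thesis
    by (rule Lim_transform_eventually)
qed

section \<open>The mean absolute value of the walk\<close>

text \<open>
  An extended nonnegative real, so that it can be compared with the cost of a coupling, which
  is not known to be integrable beforehand.
\<close>

definition mean_abs :: "nat \<Rightarrow> ennreal" where
  "mean_abs m = (\<integral>\<^sup>+x. ennreal \<bar>real_of_int x\<bar> \<partial>measure_pmf (walk m))"

text \<open>
  The two neighbours of an integer \<open>x\<close> have mean absolute value \<open>\<bar>x\<bar>\<close>, except for \<open>x = 0\<close>, where
  the mean is one.
\<close>

lemma mean_abs_Suc: "mean_abs (Suc m) = mean_abs m + ennreal (pmf (walk m) 0)"
proof -
  have *: "(\<integral>\<^sup>+s. ennreal \<bar>real_of_int (x + s)\<bar> \<partial>measure_pmf (pmf_of_set {- 1, 1})) =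
      ennreal \<bar>real_of_int x\<bar> + indicator {0} x" for x :: int
  proof -
    have "(\<integral>\<^sup>+s. ennreal \<bar>real_of_int (x + s)\<bar> \<partial>measure_pmf (pmf_of_set {- 1, 1})) =
        ennreal ((\<bar>real_of_int (x - 1)\<bar> + \<bar>real_of_int (x + 1)\<bar>) / 2)"
      by (subst nn_integral_pmf_of_set)
         (auto simp: divide_ennreal simp flip: ennreal_plus ennreal_numeral)
    also have "(\<bar>real_of_int (x - 1)\<bar> + \<bar>real_of_int (x + 1)\<bar>) / 2 = \<bar>real_of_int x\<bar> + indicator {0} x"
      by (cases "x = 0"; cases "x > 0") (auto simp: abs_if)
    finally show ?thesis
      by (simp add: ennreal_indicator)
  qed
  have "mean_abs (Suc m) = (\<integral>\<^sup>+x. ennreal \<bar>real_of_int x\<bar> + indicator {0} x \<partial>measure_pmf (walk m))"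
    by (simp add: mean_abs_def * del: of_int_add)
  then show ?thesis
    by (simp add: mean_abs_def nn_integral_add emeasure_pmf_single)
qed

lemma mean_abs_finite: "mean_abs m < \<infinity>"
  by (induction m) (simp_all add: mean_abs_Suc, simp add: mean_abs_def)

text \<open>
  Of the two steps only the first contributes: after it the walk is at an odd place.
\<close>

lemma mean_abs_add_2:
  assumes "even m"
  shows "mean_abs (m + 2) = mean_abs m + ennreal (pmf (walk m) 0)"
proof -
  have "pmf (walk (Suc m)) 0 = 0"
    by (rule pmf_walk_wrong_parity) (use assms in simp)
  then show ?thesis
    by (simp add: mean_abs_Suc)
qed


section \<open>Laws of sums of fair signs\<close>

definition walk_law :: "nat \<Rightarrow> real measure" where
  "walk_law m = distr (measure_pmf (walk m)) borel real_of_int"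

lemma walk_law_convolution: "walk_law m \<star> walk_law n = walk_law (m + n)"
proof (rule measure_eqI)
  fix A assume "A \<in> sets (walk_law m \<star> walk_law n)"
  then have A [measurable]: "A \<in> sets borel" by simp
  have fin: "finite_measure (walk_law k)" for k
    unfolding walk_law_def
    by (intro finite_measure.finite_measure_distr measure_pmf.finite_measure_axioms) simp
  interpret sigma_finite_measure "walk_law n"
    by (rule finite_measure.sigma_finite_measure[OF fin])
  have [measurable_cong]: "sets (walk_law k) = sets borel" for k
    by (simp add: walk_law_def)
  have "emeasure (walk_law m \<star> walk_law n) A =
      (\<integral>\<^sup>+x. \<integral>\<^sup>+y. indicator A (x + y) \<partial>walk_law n \<partial>walk_law m)"
    by (intro convolution_emeasure' A fin) (simp_all add: walk_law_def)
  also have "\<dots> = (\<integral>\<^sup>+x. \<integral>\<^sup>+y. indicator A (real_of_int x + y) \<partial>walk_law n \<partial>measure_pmf (walk m))"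
    unfolding walk_law_def[of m] by (subst nn_integral_distr) measurable
  also have "\<dots> = (\<integral>\<^sup>+x. \<integral>\<^sup>+y. indicator A (real_of_int x + real_of_int y) \<partial>measure_pmf (walk n) \<partial>measure_pmf (walk m))"
    unfolding walk_law_def[of n] by (subst nn_integral_distr) measurable
  also have "\<dots> = (\<integral>\<^sup>+x. indicator A (real_of_int x) \<partial>measure_pmf (walk (m + n)))"
    by (simp add: walk_add)
  also have "\<dots> = (\<integral>\<^sup>+x. indicator A x \<partial>walk_law (m + n))"
    unfolding walk_law_def by (subst nn_integral_distr) measurable
  also have "\<dots> = emeasure (walk_law (m + n)) A"
    by (simp add: walk_law_def)
  finally show "emeasure (walk_law m \<star> walk_law n) A = emeasure (walk_law (m + n)) A" .
qed (simp add: walk_law_def)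

lemma (in prob_space) distr_fair_sign:
  fixes Z :: "'a \<Rightarrow> real"
  assumes [measurable]: "random_variable borel Z"
    and plus: "prob {\<omega> \<in> space M. Z \<omega> = 1} = 1 / 2"
    and minus: "prob {\<omega> \<in> space M. Z \<omega> = - 1} = 1 / 2"
  shows "distr M borel Z = walk_law 1"
proof (rule measure_eqI)
  fix A assume "A \<in> sets (distr M borel Z)"
  then have [measurable]: "A \<in> sets borel" by simp
  let ?P = "{\<omega> \<in> space M. Z \<omega> = 1}" and ?N = "{\<omega> \<in> space M. Z \<omega> = - 1}"
  have "prob (?P \<union> ?N) = 1"
    by (subst finite_measure_Union) (auto simp: plus minus)
  then have ae: "AE \<omega> in M. Z \<omega> = 1 \<or> Z \<omega> = - 1"
    by (subst (asm) prob_eq_1) auto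
  have "emeasure (distr M borel Z) A = (\<integral>\<^sup>+\<omega>. indicator A (Z \<omega>) \<partial>M)"
    by (subst nn_integral_distr[symmetric, of _ _ borel "indicator A"]) simp_all
  also have "\<dots> = (\<integral>\<^sup>+\<omega>. indicator A 1 * indicator ?P \<omega> + indicator A (- 1) * indicator ?N \<omega> \<partial>M)"
  proof (rule nn_integral_cong_AE)
    show "AE \<omega> in M. indicator A (Z \<omega>) =
        (indicator A 1 * indicator ?P \<omega> + indicator A (- 1) * indicator ?N \<omega> :: ennreal)"
      using ae AE_space by eventually_elim (auto split: split_indicator)
  qed
  also have "\<dots> = indicator A 1 * emeasure M ?P + indicator A (- 1) * emeasure M ?N"
    by (subst nn_integral_add) (simp_all add: nn_integral_cmult)
  also have "\<dots> = (\<integral>\<^sup>+x. indicator A (real_of_int x) \<partial>measure_pmf (walk 1))"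
  proof -
    have "walk 1 = pmf_of_set {- 1, 1}"
      by (simp add: bind_return_pmf pmf.map_ident_strong)
    then have "(\<integral>\<^sup>+x. f x \<partial>measure_pmf (walk 1)) = f (- 1) * ennreal (1 / 2) + f 1 * ennreal (1 / 2)"
      for f :: "int \<Rightarrow> ennreal"
      by (simp only:) (subst nn_integral_measure_pmf_finite, simp_all)
    from this[of "\<lambda>x. indicator A (real_of_int x)"] show ?thesis
      by (simp only:) (simp add: emeasure_eq_measure plus minus add.commute)
  qed
  also have "\<dots> = (\<integral>\<^sup>+x. indicator A x \<partial>walk_law 1)"
    unfolding walk_law_def by (subst nn_integral_distr) measurable
  also have "\<dots> = emeasure (walk_law 1) A"
    by (simp add: walk_law_def)
  finally show "emeasure (distr M borel Z) A = emeasure (walk_law 1) A" .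
qed (simp add: walk_law_def)

lemma (in prob_space) distr_sum_fair_signs:
  fixes Z :: "nat \<Rightarrow> 'a \<Rightarrow> real"
  assumes indep: "indep_vars (\<lambda>_. borel) Z {1..}"
    and law: "\<And>i. i \<ge> 1 \<Longrightarrow> distr M borel (Z i) = walk_law 1"
    and "m \<ge> 1"
  shows "distr M borel (\<lambda>\<omega>. \<Sum>i = 1..m. Z i \<omega>) = walk_law m"
  using \<open>m \<ge> 1\<close>
proof (induction m rule: nat_induct_at_least)
  case base
  then show ?case using law[of 1] by simp
next
  case (Suc m)
  have Z [measurable]: "random_variable borel (Z i)" if "i \<ge> 1" for i
    using indep that unfolding indep_vars_def by auto
  have "indep_var borel (Z (Suc m)) borel (\<lambda>\<omega>. \<Sum>i = 1..m. Z i \<omega>)"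
    by (rule indep_vars_sum) (auto intro: indep_vars_subset[OF indep])
  then have "distr M borel (\<lambda>\<omega>. Z (Suc m) \<omega> + (\<Sum>i = 1..m. Z i \<omega>)) =
      (distr M borel (Z (Suc m)) \<star> distr M borel (\<lambda>\<omega>. \<Sum>i = 1..m. Z i \<omega>))"
    by (rule sum_indep_random_variable) (use Z in auto)
  also have "\<dots> = walk_law (Suc m)"
    using law[of "Suc m"] Suc.IH walk_law_convolution[of 1 m] by simp
  finally show ?case by (simp add: add.commute)
qed

section \<open>Lower bounds for the transport cost\<close>

lemma walk_law_AE_lattice:
  assumes [measurable]: "X \<in> borel_measurable N" and X: "distr N borel X = walk_law m"
  shows "AE \<omega> in N. \<exists>i. X \<omega> = real_of_int i \<and> (even i \<longleftrightarrow> even m)"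
proof -
  let ?L = "real_of_int ` {i. even i \<longleftrightarrow> even m}"
  have "countable ?L"
    by (rule countable_image) (rule countableI_type)
  then have "?L \<in> sets borel"
    by (rule sets.countable[rotated]) simp
  then have L: "{x \<in> space borel. x \<in> ?L} \<in> sets borel"
    by simp
  have "AE i in measure_pmf (walk m). real_of_int i \<in> ?L"
    by (rule AE_pmfI) (simp add: walk_parity)
  then have "AE x in distr N borel X. x \<in> ?L"
    unfolding X walk_law_def by (subst AE_distr_iff[OF _ L]) simp_all
  then have "AE \<omega> in N. X \<omega> \<in> ?L"
    by (subst (asm) AE_distr_iff[OF _ L]) simp_all
  then show ?thesis
    by eventually_elim auto
qed

lemma nn_integral_abs_walk_law:
  assumes [measurable]: "X \<in> borel_measurable N" and X: "distr N borel X = walk_law m"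
  shows "(\<integral>\<^sup>+\<omega>. ennreal \<bar>X \<omega>\<bar> \<partial>N) = mean_abs m"
proof -
  have "(\<integral>\<^sup>+\<omega>. ennreal \<bar>X \<omega>\<bar> \<partial>N) = (\<integral>\<^sup>+x. ennreal \<bar>x\<bar> \<partial>walk_law m)"
    unfolding X[symmetric] by (subst nn_integral_distr) auto
  also have "\<dots> = mean_abs m"
    unfolding walk_law_def mean_abs_def by (subst nn_integral_distr) auto
  finally show ?thesis .
qed

text \<open>
  On even integers a nonzero distance is at least two, so its square is at least twice the
  distance. Written without subtraction, as needed for extended nonnegative reals.
\<close>

lemma even_square_diff_ge:
  fixes i j :: int
  assumes "even i" "even j"
  shows "2 * \<bar>j\<bar> \<le> (i - j)\<^sup>2 + 2 * \<bar>i\<bar>"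
proof -
  from assms have "even \<bar>i - j\<bar>" by simp
  then obtain d where d: "\<bar>i - j\<bar> = 2 * d" ..
  then have "d \<ge> 0" by simp
  have "(i - j)\<^sup>2 = 2 * \<bar>i - j\<bar> + 4 * (d * (d - 1))"
    using power2_abs[of "i - j"] by (simp add: d power2_eq_square algebra_simps)
  moreover have "0 \<le> d * (d - 1)"
    using \<open>d \<ge> 0\<close> by (cases "d = 0") auto
  ultimately have "2 * \<bar>i - j\<bar> \<le> (i - j)\<^sup>2"
    by simp
  moreover have "2 * \<bar>j\<bar> \<le> 2 * \<bar>i - j\<bar> + 2 * \<bar>i\<bar>"
    by arith
  ultimately show ?thesis by (meson add_right_mono order_trans)
qed

text \<open>
  Integrating the preceding inequality over any coupling bounds the cost below by twice the growth
  of the mean absolute value.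
\<close>

lemma wasserstein2_walk_ge:
  assumes "even m"
  shows "2 * ennreal (pmf (walk m) 0) \<le> wasserstein2 (walk_law m) (walk_law (m + 2))"
  unfolding wasserstein2_def
proof (intro Inf_greatest, clarify)
  fix N :: "(real \<times> real) measure" and X Y
  assume measX [measurable]: "X \<in> borel_measurable N"
    and measY [measurable]: "Y \<in> borel_measurable N"
    and X: "distr N borel X = walk_law m" and Y: "distr N borel Y = walk_law (m + 2)"
  let ?C = "\<integral>\<^sup>+\<omega>. ennreal ((norm (X \<omega> - Y \<omega>))\<^sup>2) \<partial>N"
  have "2 * mean_abs (m + 2) = (\<integral>\<^sup>+\<omega>. 2 * ennreal \<bar>Y \<omega>\<bar> \<partial>N)"
    by (simp add: nn_integral_cmult nn_integral_abs_walk_law[OF _ Y])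
  also have "\<dots> \<le> (\<integral>\<^sup>+\<omega>. ennreal ((norm (X \<omega> - Y \<omega>))\<^sup>2) + 2 * ennreal \<bar>X \<omega>\<bar> \<partial>N)"
  proof (rule nn_integral_mono_AE)
    show "AE \<omega> in N. 2 * ennreal \<bar>Y \<omega>\<bar> \<le> ennreal ((norm (X \<omega> - Y \<omega>))\<^sup>2) + 2 * ennreal \<bar>X \<omega>\<bar>"
      using walk_law_AE_lattice[OF measX X] walk_law_AE_lattice[OF measY Y]
    proof eventually_elim
      case (elim \<omega>)
      then obtain i j where ij: "X \<omega> = real_of_int i" "Y \<omega> = real_of_int j" "even i" "even j"
        using assms by auto
      have "real_of_int (2 * \<bar>j\<bar>) \<le> real_of_int ((i - j)\<^sup>2 + 2 * \<bar>i\<bar>)"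
        using even_square_diff_ge[OF ij(3,4)] by (simp only: of_int_le_iff)
      then have "2 * \<bar>Y \<omega>\<bar> \<le> (norm (X \<omega> - Y \<omega>))\<^sup>2 + 2 * \<bar>X \<omega>\<bar>"
        by (simp add: ij(1,2))
      then have "ennreal (2 * \<bar>Y \<omega>\<bar>) \<le> ennreal ((norm (X \<omega> - Y \<omega>))\<^sup>2 + 2 * \<bar>X \<omega>\<bar>)"
        by (rule ennreal_leI)
      then show ?case
        by (simp add: ennreal_mult')
    qed
  qed
  also have "\<dots> = 2 * mean_abs m + ?C"
    by (simp add: nn_integral_add nn_integral_cmult nn_integral_abs_walk_law[OF _ X] add.commute)
  finally have "2 * mean_abs m + 2 * ennreal (pmf (walk m) 0) \<le> 2 * mean_abs m + ?C"
    by (simp only: mean_abs_add_2[OF assms] distrib_left)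
  moreover have "2 * mean_abs m \<noteq> \<infinity>"
    using mean_abs_finite[of m] by (simp add: ennreal_mult_eq_top_iff)
  ultimately show "2 * ennreal (pmf (walk m) 0) \<le> ?C"
    by (simp add: ennreal_add_left_cancel_le)
qed

text \<open>
  The walks are carried by disjoint translates of the even integers, so no coupling can
  bring them closer than one.
\<close>

lemma wasserstein2_opposite_parity:
  assumes "even m \<noteq> even n"
  shows "1 \<le> wasserstein2 (walk_law m) (walk_law n)"
  unfolding wasserstein2_def
proof (intro Inf_greatest, clarify)
  fix N :: "(real \<times> real) measure" and X Y
  assume N: "prob_space N" and measX [measurable]: "X \<in> borel_measurable N"
    and measY [measurable]: "Y \<in> borel_measurable N"
    and X: "distr N borel X = walk_law m" and Y: "distr N borel Y = walk_law n"
  have "AE \<omega> in N. 1 \<le> ennreal ((norm (X \<omega> - Y \<omega>))\<^sup>2)"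
    using walk_law_AE_lattice[OF measX X] walk_law_AE_lattice[OF measY Y]
  proof eventually_elim
    case (elim \<omega>)
    then obtain i j where ij: "X \<omega> = real_of_int i" "Y \<omega> = real_of_int j" "i \<noteq> j"
      using assms by auto
    have "1 \<le> \<bar>real_of_int (i - j)\<bar>"
      using ij(3) by linarith
    then have "1 \<le> \<bar>real_of_int (i - j)\<bar>\<^sup>2"
      by (rule one_le_power)
    then have "ennreal 1 \<le> ennreal ((norm (X \<omega> - Y \<omega>))\<^sup>2)"
      by (intro ennreal_leI) (simp add: ij(1,2))
    then show ?case by simp
  qed
  then have "(\<integral>\<^sup>+\<omega>. 1 \<partial>N) \<le> (\<integral>\<^sup>+\<omega>. ennreal ((norm (X \<omega> - Y \<omega>))\<^sup>2) \<partial>N)"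
    by (rule nn_integral_mono_AE)
  then show "1 \<le> (\<integral>\<^sup>+\<omega>. ennreal ((norm (X \<omega> - Y \<omega>))\<^sup>2) \<partial>N)"
    by (simp add: prob_space.emeasure_space_1[OF N])
qed

section \<open>An optimal coupling by cancelling opposite flows\<close>

text \<open>
  The net flow from \<open>x\<close> to \<open>x + s\<close>, \<open>(p x - p (x + s))\<^sup>+ / 4\<close>, must leave from mass \<open>p x\<close>.
  As the direction \<open>s\<close> is drawn uniformly from two values beforehand, the conditional probability
  of moving is twice the quotient, hence the division by two here. Where \<open>p x = 0\<close> the value is
  \<open>1 / 2\<close>, still a probability, and no mass is affected.
\<close>

definition move_prob :: "int pmf \<Rightarrow> int \<Rightarrow> int \<Rightarrow> real" where
  "move_prob p s x = max 0 (1 - pmf p (x + s) / pmf p x) / 2"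

lemma move_prob_bounds: "0 \<le> move_prob p s x" "move_prob p s x \<le> 1"
proof -
  have "- 1 \<le> pmf p (x + s) / pmf p x"
    by (rule order_trans[of _ 0]) simp_all
  then show "0 \<le> move_prob p s x" "move_prob p s x \<le> 1"
    unfolding move_prob_def max_def by simp_all
qed

lemma pmf_times_move_prob: "pmf p x * move_prob p s x = max 0 (pmf p x - pmf p (x + s)) / 2"
proof (cases "pmf p x = 0")
  case False
  then have "pmf p x > 0" by (simp add: pmf_pos)
  then show ?thesis by (simp add: move_prob_def max_def field_simps)
qed simp

definition flow_coupling :: "int pmf \<Rightarrow> (int \<times> int) pmf" where
  "flow_coupling p = do {
     s \<leftarrow> pmf_of_set {- 2, 2};
     x \<leftarrow> p;
     b \<leftarrow> bernoulli_pmf (move_prob p s x);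
     return_pmf (x, if b then x + s else x)
   }"

lemma fst_flow_coupling: "map_pmf fst (flow_coupling p) = p"
  by (simp add: flow_coupling_def map_bind_pmf bind_return_pmf')

text \<open>
  Inflow minus outflow across an edge is the difference of positive and negative parts of
  \<open>p (y \<plusminus> 2) - p y\<close>, which is linear in \<open>p\<close>. So the second marginal is what the lazy walk with steps
  \<open>- 2, 0, 0, 2\<close> would give, whatever the shape of \<open>p\<close>.
\<close>

lemma pmf_snd_flow_coupling:
  "pmf (map_pmf snd (flow_coupling p)) y = pmf p y / 2 + (pmf p (y - 2) + pmf p (y + 2)) / 4"
proof -
  \<comment> \<open>The law of the new position, given that the direction is \<open>s\<close>.\<close>
  define q where "q s = bind_pmf p (\<lambda>x. bind_pmf (bernoulli_pmf (move_prob p s x))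
    (\<lambda>b. return_pmf (if b then x + s else x)))" for s
  have q: "pmf (q s) y = max 0 (pmf p (y - s) - pmf p y) / 2 + pmf p y - max 0 (pmf p y - pmf p (y + s)) / 2"
    if "s \<noteq> 0" for s
  proof -
    have "pmf (q s) y =
        (\<integral>x. of_bool (x = y - s) * move_prob p s x + of_bool (x = y) * (1 - move_prob p s x) \<partial>measure_pmf p)"
      unfolding q_def pmf_bind
      by (intro Bochner_Integration.integral_cong refl) (auto simp: move_prob_bounds that)
    also have "\<dots> = (\<Sum>x\<in>{y - s, y}. (of_bool (x = y - s) * move_prob p s x +
        of_bool (x = y) * (1 - move_prob p s x)) * pmf p x)"
      by (rule integral_measure_pmf_real) auto
    also have "\<dots> = pmf p (y - s) * move_prob p s (y - s) + pmf p y - pmf p y * move_prob p s y"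
      using that by (simp add: algebra_simps)
    finally show ?thesis
      by (simp add: pmf_times_move_prob)
  qed
  have "map_pmf snd (flow_coupling p) = bind_pmf (pmf_of_set {- 2, 2}) q"
    by (simp add: flow_coupling_def q_def[abs_def] map_bind_pmf)
  then have "pmf (map_pmf snd (flow_coupling p)) y = (pmf (q (- 2)) y + pmf (q 2) y) / 2"
    by (simp add: pmf_bind_pmf_of_set)
  then show ?thesis
    by (simp add: q max_def field_simps split: if_splits)
qed

lemma snd_flow_coupling_walk: "map_pmf snd (flow_coupling (walk m)) = walk (m + 2)"
proof (rule pmf_eqI)
  fix y
  show "pmf (map_pmf snd (flow_coupling (walk m))) y = pmf (walk (m + 2)) y"
    using pmf_walk_Suc[of "Suc m" y] pmf_walk_Suc[of m "y - 1"] pmf_walk_Suc[of m "y + 1"]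
    by (simp add: pmf_snd_flow_coupling del: walk.simps) (simp add: field_simps)
qed

text \<open>
  Both inequalities of the lower bound are equalities on the support of the coupling: a pair is
  either at rest or moved outwards by exactly two.
\<close>

lemma flow_coupling_walk_outward:
  assumes "(x, y) \<in> set_pmf (flow_coupling (walk m))"
  shows "(x - y)\<^sup>2 + 2 * \<bar>x\<bar> = 2 * \<bar>y\<bar>"
proof -
  from assms obtain s b where s: "s \<in> {- 2, 2}" and x: "x \<in> set_pmf (walk m)"
    and b: "b \<in> set_pmf (bernoulli_pmf (move_prob (walk m) s x))" and y: "y = (if b then x + s else x)"
    by (auto simp: flow_coupling_def)
  show ?thesis
  proof (cases b)
    case True
    have "move_prob (walk m) s x \<noteq> 0"
    proof
      assume "move_prob (walk m) s x = 0"
      with b True show False by (simp add: set_pmf_iff)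
    qed
    moreover have "pmf (walk m) x > 0"
      using x by (simp add: pmf_positive)
    ultimately have "pmf (walk m) (x + s) < pmf (walk m) x"
      by (simp add: move_prob_def max_def field_simps split: if_splits)
    from walk_drop_outward[OF this s] show ?thesis
      using s True y by auto
  qed (use y in simp)
qed

lemma wasserstein2_walk_le:
  assumes "even m"
  shows "wasserstein2 (walk_law m) (walk_law (m + 2)) \<le> 2 * ennreal (pmf (walk m) 0)"
proof -
  let ?F = "flow_coupling (walk m)"
  let ?X = "\<lambda>z. real_of_int (fst z)" and ?Y = "\<lambda>z. real_of_int (snd z)"
  let ?C = "\<integral>\<^sup>+z. ennreal ((norm (?X z - ?Y z))\<^sup>2) \<partial>measure_pmf ?F"
  have X: "distr (measure_pmf ?F) borel ?X = walk_law m"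
    unfolding walk_law_def
    by (subst fst_flow_coupling[of "walk m", symmetric], subst map_pmf_rep_eq, subst distr_distr)
       (simp_all add: comp_def)
  have Y: "distr (measure_pmf ?F) borel ?Y = walk_law (m + 2)"
    unfolding walk_law_def
    by (subst snd_flow_coupling_walk[of m, symmetric], subst map_pmf_rep_eq, subst distr_distr)
       (simp_all add: comp_def)
  have "2 * mean_abs m + ?C = (\<integral>\<^sup>+z. ennreal ((norm (?X z - ?Y z))\<^sup>2) + 2 * ennreal \<bar>?X z\<bar> \<partial>measure_pmf ?F)"
    by (simp add: nn_integral_add nn_integral_cmult nn_integral_abs_walk_law[OF _ X] add.commute)
  also have "\<dots> = (\<integral>\<^sup>+z. 2 * ennreal \<bar>?Y z\<bar> \<partial>measure_pmf ?F)"
  proof (intro nn_integral_cong_AE AE_pmfI)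
    fix z assume "z \<in> set_pmf ?F"
    then have "(fst z - snd z)\<^sup>2 + 2 * \<bar>fst z\<bar> = 2 * \<bar>snd z\<bar>"
      by (intro flow_coupling_walk_outward) simp
    then have "real_of_int ((fst z - snd z)\<^sup>2 + 2 * \<bar>fst z\<bar>) = real_of_int (2 * \<bar>snd z\<bar>)"
      by (simp only:)
    then have "(norm (?X z - ?Y z))\<^sup>2 + 2 * \<bar>?X z\<bar> = 2 * \<bar>?Y z\<bar>"
      by simp
    then have "ennreal ((norm (?X z - ?Y z))\<^sup>2 + 2 * \<bar>?X z\<bar>) = ennreal (2 * \<bar>?Y z\<bar>)"
      by simp
    then show "ennreal ((norm (?X z - ?Y z))\<^sup>2) + 2 * ennreal \<bar>?X z\<bar> = 2 * ennreal \<bar>?Y z\<bar>"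
      by (simp add: ennreal_mult')
  qed
  also have "\<dots> = 2 * mean_abs (m + 2)"
    by (simp add: nn_integral_cmult nn_integral_abs_walk_law[OF _ Y])
  also have "\<dots> = 2 * mean_abs m + 2 * ennreal (pmf (walk m) 0)"
    by (simp only: mean_abs_add_2[OF assms] distrib_left)
  finally have "?C = 2 * ennreal (pmf (walk m) 0)"
    using mean_abs_finite[of m] by (auto simp: ennreal_add_left_cancel ennreal_mult_eq_top_iff)
  moreover have "wasserstein2 (walk_law m) (walk_law (m + 2)) \<le> ?C"
    by (rule wasserstein2_le[OF measure_pmf.prob_space_axioms _ _ X Y]) simp_all
  ultimately show ?thesis by simp
qed

lemma wasserstein2_walk:
  "even m \<Longrightarrow> wasserstein2 (walk_law m) (walk_law (m + 2)) = 2 * ennreal (pmf (walk m) 0)"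
  by (intro antisym wasserstein2_walk_le wasserstein2_walk_ge)

section \<open>The two regimes\<close>

theorem proposition1:
  fixes M :: "'a measure" and Z :: "nat \<Rightarrow> 'a \<Rightarrow> real"
    and \<mu> \<nu> :: "nat \<Rightarrow> real measure"
  assumes prob: "prob_space M"
    and indep: "prob_space.indep_vars M (\<lambda>_. borel) Z {1..}"
    and ident: "\<And>i. i \<ge> 1 \<Longrightarrow> distr M borel (Z i) = distr M borel (Z 1)"
    and plus: "measure M {\<omega> \<in> space M. Z 1 \<omega> = 1} = 1 / 2"
    and minus: "measure M {\<omega> \<in> space M. Z 1 \<omega> = - 1} = 1 / 2"
    and mu: "\<And>n. n \<ge> 1 \<Longrightarrow> \<mu> n = distr M borel (\<lambda>\<omega>. \<Sum>i = 1..2 * n - 1. Z i \<omega>)"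
    and nu: "\<And>n. n \<ge> 1 \<Longrightarrow> \<nu> n = distr M borel (\<lambda>\<omega>. \<Sum>i = 1..2 * n. Z i \<omega>)"
  shows "((\<lambda>n. ennreal (sqrt (real n)) * wasserstein2 (\<mu> n \<star> \<mu> n) (\<nu> n \<star> \<nu> n))
            \<longlonglongrightarrow> ennreal (2 / sqrt (2 * pi))) \<and>
         (\<forall>n\<ge>1. wasserstein2 ((\<mu> n \<star> \<mu> n) \<star> \<mu> n) ((\<nu> n \<star> \<nu> n) \<star> \<nu> n) \<ge> 1)"
proof -
  interpret prob_space M by (rule prob)
  have "random_variable borel (Z 1)"
    using indep unfolding indep_vars_def by auto
  from distr_fair_sign[OF this plus minus] have "distr M borel (Z 1) = walk_law 1" .
  then have Z: "distr M borel (Z i) = walk_law 1" if "i \<ge> 1" for i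
    using ident[OF that] by simp
  have laws: "\<mu> n = walk_law (2 * n - 1)" "\<nu> n = walk_law (2 * n)" if "n \<ge> 1" for n
    using distr_sum_fair_signs[OF indep Z, of "2 * n - 1"] distr_sum_fair_signs[OF indep Z, of "2 * n"] that
    by (simp_all add: mu nu)
  have "(\<lambda>n. ennreal (sqrt (real n) * (2 * pmf (walk (4 * n - 2)) 0))) \<longlonglongrightarrow> ennreal (2 / sqrt (2 * pi))"
    by (intro tendsto_ennrealI walk_return_asymptotics)
  moreover have "\<forall>\<^sub>F n in sequentially. ennreal (sqrt (real n) * (2 * pmf (walk (4 * n - 2)) 0)) =
      ennreal (sqrt (real n)) * wasserstein2 (\<mu> n \<star> \<mu> n) (\<nu> n \<star> \<nu> n)"
    using eventually_ge_at_top[of 1]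
  proof eventually_elim
    case (elim n)
    then have "2 * n - 1 + (2 * n - 1) = 4 * n - 2" "2 * n + 2 * n = 4 * n - 2 + 2"
      by simp_all
    then have "(\<mu> n \<star> \<mu> n) = walk_law (4 * n - 2)" "(\<nu> n \<star> \<nu> n) = walk_law (4 * n - 2 + 2)"
      by (simp_all only: laws[OF elim] walk_law_convolution)
    then have "wasserstein2 (\<mu> n \<star> \<mu> n) (\<nu> n \<star> \<nu> n) = 2 * ennreal (pmf (walk (4 * n - 2)) 0)"
      using wasserstein2_walk[of "4 * n - 2"] by simp
    then show ?case
      by (simp add: ennreal_mult)
  qed
  ultimately have "(\<lambda>n. ennreal (sqrt (real n)) * wasserstein2 (\<mu> n \<star> \<mu> n) (\<nu> n \<star> \<nu> n))
      \<longlonglongrightarrow> ennreal (2 / sqrt (2 * pi))"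
    by (rule Lim_transform_eventually)
  moreover have "wasserstein2 ((\<mu> n \<star> \<mu> n) \<star> \<mu> n) ((\<nu> n \<star> \<nu> n) \<star> \<nu> n) \<ge> 1" if "n \<ge> 1" for n
    using that
    by (simp add: laws walk_law_convolution) (rule wasserstein2_opposite_parity, simp)
  ultimately show ?thesis by blast
qed

end
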